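(* Let $n\ge2$ and let $f:\mathbb{R}^n_+\to\mathbb{R}_+$ be a Spillman-Mitscherlich production model, $$f(x_1,\ldots,x_n)= A\cdot\left[1-\exp(-a_1x_1)\right]\cdots\left[1-\exp(-a_nx_n)\right],$$ where $A,a_1,\ldots,a_n$ are positive constants. Then the following assertions hold. (i) The output elasticity cannot be constant with respect to any input $x_i$, $i=1,\ldots,n$. (ii) $f$ does not satisfy the PMRS property. (iii) $f$ does not satisfy the CES property. (iv) The production hypersurface of $f$ has non-vanishing Gauss-Kronecker curvature. (v) The production hypersurface of $f$ is non-flat.
   Context: Here $\mathbb{R}^n_+=\{(x_1,\ldots,x_n): x_1>0,\ldots,x_n>0\}$, $\mathbb{R}_+=(0,\infty)$, and subscripts denote partial derivatives: $f_{x_i}=\partial f/\partial x_i$, $f_{x_ix_j}=\partial^2 f/\partial x_i\partial x_j$. The output elasticity with respect to $x_i$ is $E_{x_i}=\frac{x_i}{f}f_{x_i}$. The marginal rate of technical substitution is $\mathrm{MRS}_{ij}=f_{x_j}/f_{x_i}$. The PMRS (proportional marginal rate of substitution) property means $\mathrm{MRS}_{ij}=x_i/x_j$ for all $1\le i\ne j\le n$. The Hicks elasticity of substitution between $x_i$ and $x_j$ ($i\neq j$) is $$H_{ij}=\frac{\frac{1}{x_if_{x_i}}+\frac{1}{x_jf_{x_j}}}{-\frac{f_{x_ix_i}}{f_{x_i}^2}+\frac{2f_{x_ix_j}}{f_{x_i}f_{x_j}}-\frac{f_{x_jx_j}}{f_{x_j}^2}}.$$ The CES (constant elasticity of substitution)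 property means there is a nonzero real constant $\sigma$ with $H_{ij}(x_1,\ldots,x_n)=\sigma$ for $(x_1,\ldots,x_n)\in\mathbb{R}^n_+$ and all $1\le i\neq j\le n$. The production hypersurface of $f$ is the graph $L(x_1,\ldots,x_n)=(x_1,\ldots,x_n,f(x_1,\ldots,x_n))$ in Euclidean space $\mathbb{E}^{n+1}$. With $w=\sqrt{1+\sum_i f_{x_i}^2}$, its Gauss-Kronecker curvature is $K=\det(f_{x_ix_j})/w^{n+2}$. It is flat if the Riemann curvature tensor of the induced metric is zero at every point, and non-flat otherwise.
   Formalization: In (iv), "non-vanishing Gauss-Kronecker curvature" is taken as "the curvature is not identically zero"; the pointwise claim is false, since the curvature vanishes wherever exp(-a_1x_1)+...+exp(-a_nx_n)=1. *)

theory Defs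
  imports "HOL-Analysis.Analysis"
begin

definition pos_orthant :: "(real ^ 'n) set" where
  "pos_orthant = {x. \<forall>i. x $ i > 0}"

(* Partial derivative along the i-th coordinate direction.  It is taken two-sided at the point x,
   so on the open set pos_orthant it only depends on the values of f near x, and the values of f
   outside pos_orthant play no role below. *)
definition pderivative ::
  "'n \<Rightarrow> (real ^ 'n \<Rightarrow> 'b::real_normed_vector) \<Rightarrow> real ^ 'n \<Rightarrow> 'b" where
  "pderivative i f x = vector_derivative (\<lambda>t::real. f (x + t *\<^sub>R axis i 1)) (at 0)"

(* f_{x_i x_j} *)
definition pderivative2 ::
  "'n \<Rightarrow> 'n \<Rightarrow> (real ^ 'n \<Rightarrow> 'b::real_normed_vector) \<Rightarrow> real ^ 'n \<Rightarrow> 'b" where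
  "pderivative2 i j f = pderivative j (pderivative i f)"

definition output_elasticity :: "'n \<Rightarrow> (real ^ 'n \<Rightarrow> real) \<Rightarrow> real ^ 'n \<Rightarrow> real" where
  "output_elasticity i f x = x $ i / f x * pderivative i f x"

(* Note the order of the indices: MRS_ij is f_{x_j} divided by f_{x_i}. *)
definition MRS :: "'n \<Rightarrow> 'n \<Rightarrow> (real ^ 'n \<Rightarrow> real) \<Rightarrow> real ^ 'n \<Rightarrow> real" where
  "MRS i j f x = pderivative j f x / pderivative i f x"

definition PMRS :: "(real ^ 'n \<Rightarrow> real) \<Rightarrow> bool" where
  "PMRS f \<longleftrightarrow> (\<forall>x\<in>pos_orthant. \<forall>i j. i \<noteq> j \<longrightarrow> MRS i j f x = x $ i / x $ j)"

definition hicks_elasticity ::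
  "'n \<Rightarrow> 'n \<Rightarrow> (real ^ 'n \<Rightarrow> real) \<Rightarrow> real ^ 'n \<Rightarrow> real" where
  "hicks_elasticity i j f x =
     (1 / (x $ i * pderivative i f x) + 1 / (x $ j * pderivative j f x)) /
     (- (pderivative2 i i f x / (pderivative i f x)\<^sup>2)
      + 2 * pderivative2 i j f x / (pderivative i f x * pderivative j f x)
      - pderivative2 j j f x / (pderivative j f x)\<^sup>2)"

definition CES :: "(real ^ 'n \<Rightarrow> real) \<Rightarrow> bool" where
  "CES f \<longleftrightarrow> (\<exists>\<sigma>. \<sigma> \<noteq> 0 \<and>
     (\<forall>x\<in>pos_orthant. \<forall>i j. i \<noteq> j \<longrightarrow> hicks_elasticity i j f x = \<sigma>))"

(* The graph parametrisation L; Euclidean (n+1)-space is the inner product space R^n x R. *)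
definition production_hypersurface ::
  "(real ^ 'n \<Rightarrow> real) \<Rightarrow> real ^ 'n \<Rightarrow> (real ^ 'n) \<times> real" where
  "production_hypersurface f x = (x, f x)"

definition gauss_kronecker_curvature ::
  "(real ^ 'n \<Rightarrow> real) \<Rightarrow> real ^ 'n \<Rightarrow> real" where
  "gauss_kronecker_curvature f x =
     det (\<chi> i j. pderivative2 i j f x) /
     sqrt (1 + (\<Sum>i\<in>UNIV. (pderivative i f x)\<^sup>2)) ^ (CARD('n) + 2)"

definition induced_metric ::
  "(real ^ 'n \<Rightarrow> 'b::real_inner) \<Rightarrow> real ^ 'n \<Rightarrow> real ^ 'n ^ 'n" where
  "induced_metric L x = (\<chi> i j. pderivative i L x \<bullet> pderivative j L x)"

(* Christoffel symbol of the Levi-Civita connection: christoffel g k i j is Gamma^k_{ij}. *)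
definition christoffel ::
  "(real ^ 'n \<Rightarrow> real ^ 'n ^ 'n) \<Rightarrow> 'n \<Rightarrow> 'n \<Rightarrow> 'n \<Rightarrow> real ^ 'n \<Rightarrow> real" where
  "christoffel g k i j x =
     (1 / 2) * (\<Sum>l\<in>UNIV. matrix_inv (g x) $ k $ l *
        (pderivative i (\<lambda>y. g y $ j $ l) x + pderivative j (\<lambda>y. g y $ i $ l) x
         - pderivative l (\<lambda>y. g y $ i $ j) x))"

(* riemann g l k i j is the component R^l_{kij}, i.e. the l-th coordinate of R(d_i, d_j) d_k
   where R(X,Y) = [nabla_X, nabla_Y] - nabla_[X,Y]. *)
definition riemann ::
  "(real ^ 'n \<Rightarrow> real ^ 'n ^ 'n) \<Rightarrow> 'n \<Rightarrow> 'n \<Rightarrow> 'n \<Rightarrow> 'n \<Rightarrow> real ^ 'n \<Rightarrow> real" where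
  "riemann g l k i j x =
     pderivative i (christoffel g l j k) x - pderivative j (christoffel g l i k) x
     + (\<Sum>m\<in>UNIV. christoffel g l i m x * christoffel g m j k x
                   - christoffel g l j m x * christoffel g m i k x)"

definition flat_on :: "(real ^ 'n) set \<Rightarrow> (real ^ 'n \<Rightarrow> 'b::real_inner) \<Rightarrow> bool" where
  "flat_on S L \<longleftrightarrow> (\<forall>x\<in>S. \<forall>l k i j. riemann (induced_metric L) l k i j x = 0)"

definition spillman_mitscherlich ::
  "real \<Rightarrow> ('n \<Rightarrow> real) \<Rightarrow> (real ^ 'n \<Rightarrow> real) \<Rightarrow> bool" where
  "spillman_mitscherlich A a f \<longleftrightarrow> A > 0 \<and> (\<forall>i. a i > 0) \<and>
     (\<forall>x\<in>pos_orthant. f x = A * (\<Prod>i\<in>UNIV. 1 - exp (- a i * x $ i)))"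

end

(* With u_i = a_i / (exp (a_i x_i) - 1), the function satisfies f_i = u_i f, f_ii = - a_i u_i f and
   f_ij = u_i u_j f for i, j distinct.  So E_i = x_i u_i, which is not constant; PMRS would mean
   x_i u_i = x_j u_j; and on the ray a_i x_i = t all H_ij equal (1 - exp (-t)) / t, which depends
   on t.  The Hessian is f (u u^T - diag (a_i u_i + u_i^2)), singular only where the sum of the
   exp (- a_i x_i) is 1.  By the Gauss equation, flatness of a graph forces every 2x2 minor of the
   Hessian to vanish, but f_ii f_jj = f_ij^2 fails at a_i x_i = 1. *)

theory Submission
  imports Defs
begin

section \<open>Calculus of partial derivatives\<close>

text \<open>\<open>pderivative\<close> is total and says nothing about existence; the relation
  records that the derivative exists, which the sum, product and quotient rules need.\<close>

definition has_pderivative ::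
  "'n \<Rightarrow> (real ^ 'n \<Rightarrow> 'b::real_normed_vector) \<Rightarrow> real ^ 'n \<Rightarrow> 'b \<Rightarrow> bool" where
  "has_pderivative i f x D \<longleftrightarrow> ((\<lambda>t. f (x + t *\<^sub>R axis i 1)) has_vector_derivative D) (at 0)"

lemma pderivative_eqI: "has_pderivative i f x D \<Longrightarrow> pderivative i f x = D"
  unfolding has_pderivative_def pderivative_def by (rule vector_derivative_at)

lemma has_pderivative_real_iff:
  "has_pderivative i f x D \<longleftrightarrow> ((\<lambda>t. f (x + t *\<^sub>R axis i 1)) has_real_derivative D) (at 0)"
  unfolding has_pderivative_def has_real_derivative_iff_has_vector_derivative ..

text \<open>The line t |-> x + t e_i pulls \<open>S\<close> back to an open set around 0. This
  allows \<open>f\<close> and its derivatives to be replaced by formulas that hold only on the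
  orthant.\<close>

lemma has_pderivative_transform_open:
  assumes "has_pderivative i f x D" "open S" "x \<in> S" "\<And>y. y \<in> S \<Longrightarrow> f y = g y"
  shows "has_pderivative i g x D"
proof -
  let ?h = "\<lambda>t::real. x + t *\<^sub>R axis i (1::real)"
  have "open (?h -` S)"
    by (rule continuous_open_vimage[OF \<open>open S\<close>]) (auto intro!: continuous_intros)
  then show ?thesis
    using assms unfolding has_pderivative_def
    by (elim has_vector_derivative_transform_within_open[where S = "?h -` S"]) auto
qed

lemma open_pos_orthant: "open (pos_orthant :: (real ^ 'n) set)"
proof -
  have "pos_orthant = (\<Inter>i. {x :: real ^ 'n. 0 < x $ i})"
    by (auto simp: pos_orthant_def)
  moreover have "open (\<Inter>i. {x :: real ^ 'n. 0 < x $ i})"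
    by (intro open_INT ballI open_Collect_less) (auto intro!: continuous_intros)
  ultimately show ?thesis by simp
qed

section \<open>Intrinsic curvature of a graph\<close>

lemma matrix_inv_unique:
  fixes M N :: "real ^ 'n ^ 'n"
  assumes "M ** N = mat 1" "N ** M = mat 1"
  shows "matrix_inv M = N"
proof -
  have "M ** matrix_inv M = mat 1 \<and> matrix_inv M ** M = mat 1"
    unfolding matrix_inv_def by (rule someI[of _ N]) (use assms in simp)
  then show ?thesis
    by (metis assms(1) matrix_mul_assoc matrix_mul_lid matrix_mul_rid)
qed

text \<open>Sherman-Morrison formula for I + v v^T, which is the metric of a graph when v is the
  gradient.\<close>

lemma matrix_inv_mat_plus_outer:
  fixes v :: "'n::finite \<Rightarrow> real" and M :: "real ^ 'n ^ 'n"
  defines "W \<equiv> 1 + (\<Sum>i\<in>UNIV. (v i)\<^sup>2)"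
  assumes "\<And>i j. M $ i $ j = (if i = j then 1 else 0) + v i * v j"
  shows "matrix_inv M $ i $ j = (if i = j then 1 else 0) - v i * v j / W"
proof -
  define N :: "real ^ 'n ^ 'n" where "N = (\<chi> i j. (if i = j then 1 else 0) - v i * v j / W)"
  have "W > 0"
    unfolding W_def by (smt (verit) sum_nonneg zero_le_power2)
  \<comment> \<open>This is (I + p v v^T)(I + q v v^T) with |v|^2 = \<open>W - 1\<close>. For p, q
    equal to 1 and -1/W, in either order, the coefficient of v v^T vanishes.\<close>
  have expand: "(\<Sum>k\<in>UNIV. ((if i = k then 1 else 0) + p * (v i * v k)) * ((if k = j then 1 else 0) + q * (v k * v j)))
      = (if i = j then 1 else 0) + (p + q + p * q * (W - 1)) * (v i * v j)" for i j p q
  proof -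
    have "(\<Sum>k\<in>UNIV. ((if i = k then 1 else 0) + p * (v i * v k)) * ((if k = j then 1 else 0) + q * (v k * v j)))
      = (\<Sum>k\<in>UNIV. (if i = k then (if k = j then 1 else 0) + q * (v k * v j) else 0)
          + (if k = j then p * (v i * v k) else 0) + p * q * (v i * v j) * (v k)\<^sup>2)"
      by (intro sum.cong refl) (auto simp: algebra_simps power2_eq_square)
    also have "\<dots> = (if i = j then 1 else 0) + q * (v i * v j) + p * (v i * v j) + p * q * (v i * v j) * (W - 1)"
      by (simp add: sum.distrib W_def sum_distrib_left)
    finally show ?thesis by (simp add: algebra_simps)
  qed
  have N: "N $ i $ j = (if i = j then 1 else 0) + (-1 / W) * (v i * v j)" for i j
    by (simp add: N_def)
  have M: "M $ i $ j = (if i = j then 1 else 0) + 1 * (v i * v j)" for i j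
    using assms by simp
  have "M ** N = mat 1" "N ** M = mat 1"
    using \<open>W > 0\<close> unfolding matrix_matrix_mult_def mat_def vec_eq_iff N M vec_lambda_beta expand
    by (auto simp: field_simps)
  then have "matrix_inv M = N"
    using matrix_inv_unique by blast
  then show ?thesis by (simp add: N_def)
qed

text \<open>With gradient \<open>G\<close> and Hessian \<open>H\<close>, the metric is I + G G^T. In
  the alternating sum of its derivatives everything cancels except 2 H_ij G_l, and the inverse
  metric maps G to G / W.\<close>

lemma christoffel_graph:
  fixes f :: "real ^ 'n \<Rightarrow> real"
  defines "g \<equiv> induced_metric (production_hypersurface f)"
  assumes S: "open S" "x \<in> S"
    and f1: "\<And>y i. y \<in> S \<Longrightarrow> has_pderivative i f y (G i y)"
    and f2: "\<And>i j. has_pderivative j (G i) x (H i j)"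
    and sym: "\<And>i j. H i j = H j i"
  shows "christoffel g k i j x = G k x * H i j / (1 + (\<Sum>m\<in>UNIV. (G m x)\<^sup>2))"
proof -
  define W where "W = 1 + (\<Sum>m\<in>UNIV. (G m x)\<^sup>2)"
  have "W > 0"
    unfolding W_def by (smt (verit) sum_nonneg zero_le_power2)
  have L: "pderivative i (production_hypersurface f) y = (axis i 1, G i y)" if "y \<in> S" for y i
  proof (rule pderivative_eqI)
    have "((\<lambda>t. y + t *\<^sub>R axis i 1) has_vector_derivative axis i 1) (at 0)"
      by (auto intro!: derivative_eq_intros)
    then show "has_pderivative i (production_hypersurface f) y (axis i 1, G i y)"
      using f1[OF that, of i] unfolding has_pderivative_def production_hypersurface_def
      by (rule has_vector_derivative_Pair)
  qed
  have g: "g y $ i $ j = (if i = j then 1 else 0) + G i y * G j y" if "y \<in> S" for y i j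
    using that by (simp add: g_def induced_metric_def L inner_axis_axis)
  have dg: "pderivative k (\<lambda>y. g y $ i $ j) x = H i k * G j x + G i x * H j k" for i j k
  proof (rule pderivative_eqI, rule has_pderivative_transform_open[OF _ S])
    show "has_pderivative k (\<lambda>y. (if i = j then 1 else 0) + G i y * G j y) x (H i k * G j x + G i x * H j k)"
      using f2[of k i] f2[of k j] unfolding has_pderivative_real_iff
      by (auto intro!: derivative_eq_intros)
  qed (simp add: g)
  have inv: "matrix_inv (g x) $ k $ l = (if k = l then 1 else 0) - G k x * G l x / W" for k l
    unfolding W_def by (rule matrix_inv_mat_plus_outer) (rule g[OF S(2)])
  have "christoffel g k i j x = (\<Sum>l\<in>UNIV. (if k = l then H i j * G l x else 0) - H i j * G k x / W * (G l x)\<^sup>2)"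
    unfolding christoffel_def dg inv sum_distrib_left
    by (intro sum.cong refl) (auto simp: sym algebra_simps power2_eq_square)
  also have "\<dots> = H i j * G k x - H i j * G k x / W * (W - 1)"
    by (simp add: sum_subtractf W_def sum_distrib_left)
  also have "\<dots> = G k x * H i j / W"
    using \<open>W > 0\<close> by (simp add: field_simps)
  finally show ?thesis unfolding W_def .
qed

text \<open>Gauss equation with one index raised: \<open>V\<close> collects the 2x2 minors of the
  Hessian, the second fundamental form is H / sqrt W, and the inverse metric I - G G^T / W acts on
  the index l. The third derivatives \<open>T\<close> cancel by \<open>sym3\<close>.\<close>

lemma riemann_graph:
  fixes f :: "real ^ 'n \<Rightarrow> real"
  defines "g \<equiv> induced_metric (production_hypersurface f)"
  assumes S: "open S" "x \<in> S"
    and f1: "\<And>y i. y \<in> S \<Longrightarrow> has_pderivative i f y (G i y)"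
    and f2: "\<And>y i j. y \<in> S \<Longrightarrow> has_pderivative j (G i) y (H i j y)"
    and f3: "\<And>i j k. has_pderivative k (H i j) x (T i j k)"
    and sym: "\<And>y i j. y \<in> S \<Longrightarrow> H i j y = H j i y"
    and sym3: "\<And>i j k. T i j k = T k j i"
  defines "W \<equiv> 1 + (\<Sum>m\<in>UNIV. (G m x)\<^sup>2)"
    and "V \<equiv> \<lambda>l k i j. H l i x * H j k x - H l j x * H i k x"
  shows "riemann g l k i j x = (V l k i j - G l x * (\<Sum>m\<in>UNIV. G m x * V m k i j) / W) / W"
proof -
  define P where "P y = 1 + (\<Sum>m\<in>UNIV. (G m y)\<^sup>2)" for y
  \<comment> \<open>The gradient of \<open>P\<close> is 2 s.\<close>
  define s where "s i = (\<Sum>m\<in>UNIV. G m x * H m i x)" for i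
  have "P y > 0" for y
    unfolding P_def by (smt (verit) sum_nonneg zero_le_power2)
  then have P0: "P y \<noteq> 0" for y
    by (metis less_irrefl)
  have PW: "P x = W" by (simp add: P_def W_def)
  have ch: "christoffel g k i j y = G k y * H i j y / P y" if "y \<in> S" for y k i j
    unfolding P_def g_def by (rule christoffel_graph[OF S(1) that f1 f2[OF that] sym[OF that]])
  have dch: "pderivative i (christoffel g l j k) x =
      (H l i x * H j k x + G l x * T j k i) / W - G l x * H j k x * (2 * s i) / W\<^sup>2" for i l j k
  proof (rule pderivative_eqI, rule has_pderivative_transform_open[OF _ S])
    have "has_pderivative i P x (2 * s i)"
      using f2[OF S(2), of i] unfolding has_pderivative_real_iff P_def s_def sum_distrib_left
      by (auto intro!: derivative_eq_intros sum.cong)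
    then show "has_pderivative i (\<lambda>y. G l y * H j k y / P y) x
      ((H l i x * H j k x + G l x * T j k i) / W - G l x * H j k x * (2 * s i) / W\<^sup>2)"
      using f2[OF S(2), of i l] f3[of i j k] P0[of x] unfolding has_pderivative_real_iff PW[symmetric]
      by (auto intro!: derivative_eq_intros simp: field_simps power2_eq_square)
  qed (simp add: ch)
  have W0: "W \<noteq> 0" using P0 PW by metis
  \<comment> \<open>The products of Christoffel symbols give back half of the term with 2 s that
    comes from differentiating 1 / P.\<close>
  have q: "(\<Sum>m\<in>UNIV. christoffel g l i m x * christoffel g m j k x - christoffel g l j m x * christoffel g m i k x)
      = G l x * (H j k x * s i - H i k x * s j) / W\<^sup>2"
    unfolding ch[OF S(2)] PW s_def right_diff_distrib sum_distrib_left sum_subtractf[symmetric] sum_divide_distrib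
    by (intro sum.cong refl) (auto simp: sym[OF S(2)] diff_divide_distrib algebra_simps power2_eq_square)
  have v: "(\<Sum>m\<in>UNIV. G m x * V m k i j) = H j k x * s i - H i k x * s j"
    unfolding V_def s_def sum_distrib_left sum_subtractf[symmetric]
    by (intro sum.cong refl) (auto simp: algebra_simps)
  show ?thesis
    unfolding riemann_def dch q v
    unfolding V_def sym3[of i k j] using W0
    by (simp add: field_simps power2_eq_square)
qed

text \<open>Zero curvature says that V, as a vector in l, equals (s / W) G with s = G . V. Pairing
  with G gives s = (W - 1) s / W, so s = 0 and then V = 0.\<close>

lemma flat_graph_hessian_minor:
  fixes f :: "real ^ 'n \<Rightarrow> real"
  assumes flat: "flat_on S (production_hypersurface f)"
    and S: "open S" "x \<in> S"
    and f1: "\<And>y i. y \<in> S \<Longrightarrow> has_pderivative i f y (G i y)"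
    and f2: "\<And>y i j. y \<in> S \<Longrightarrow> has_pderivative j (G i) y (H i j y)"
    and f3: "\<And>i j k. has_pderivative k (H i j) x (T i j k)"
    and sym: "\<And>y i j. y \<in> S \<Longrightarrow> H i j y = H j i y"
    and sym3: "\<And>i j k. T i j k = T k j i"
  shows "H l i x * H j k x = H l j x * H i k x"
proof -
  define W where "W = 1 + (\<Sum>m\<in>UNIV. (G m x)\<^sup>2)"
  define V where "V l = H l i x * H j k x - H l j x * H i k x" for l
  define s where "s = (\<Sum>m\<in>UNIV. G m x * V m)"
  have "W > 0"
    unfolding W_def by (smt (verit) sum_nonneg zero_le_power2)
  have V: "V l = G l x * s / W" for l
    using riemann_graph[OF S f1 f2 f3 sym sym3, of l k i j] flat \<open>W > 0\<close> \<open>x \<in> S\<close>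
    by (auto simp: flat_on_def W_def V_def s_def)
  have "s = (\<Sum>m\<in>UNIV. (G m x)\<^sup>2 * (s / W))"
    by (subst (1) s_def, intro sum.cong refl) (simp add: V power2_eq_square)
  also have "\<dots> = (W - 1) * (s / W)"
    by (simp add: W_def sum_distrib_right sum_divide_distrib)
  finally have "s = 0"
    using \<open>W > 0\<close> by (simp add: field_simps)
  then show ?thesis
    using V[of l] by (simp add: V_def)
qed

section \<open>Derivatives of the product of exponential factors\<close>

text \<open>The k-th derivative of 1 - exp (-c t) in t; the constant 1 survives only for k =
  0.\<close>

definition sm_factor :: "real \<Rightarrow> nat \<Rightarrow> real \<Rightarrow> real" where
  "sm_factor c k t = (if k = 0 then 1 - exp (- c * t) else - ((- c) ^ k) * exp (- c * t))"

lemma sm_factor_deriv: "(sm_factor c k has_real_derivative sm_factor c (Suc k) t) (at t)"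
  unfolding sm_factor_def by (cases "k = 0") (auto intro!: derivative_eq_intros)

(* m is the multi-index of the derivative, which makes the symmetry of mixed derivatives immediate. *)
definition sm_partial :: "real \<Rightarrow> ('n \<Rightarrow> real) \<Rightarrow> ('n \<Rightarrow> nat) \<Rightarrow> real ^ 'n \<Rightarrow> real" where
  "sm_partial A a m x = A * (\<Prod>i\<in>UNIV. sm_factor (a i) (m i) (x $ i))"

definition inc :: "'n \<Rightarrow> ('n \<Rightarrow> nat) \<Rightarrow> 'n \<Rightarrow> nat" where
  "inc i m = m(i := Suc (m i))"

lemma inc_commute: "inc i (inc j m) = inc j (inc i m)"
  by (auto simp: inc_def fun_eq_iff)

lemma sm_partial_upd:
  "sm_partial A a (m(i := k)) x
    = A * (sm_factor (a i) k (x $ i) * (\<Prod>j\<in>UNIV - {i}. sm_factor (a j) (m j) (x $ j)))"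
  unfolding sm_partial_def by (subst prod.remove[of _ i]) auto

text \<open>Lifts a relation between two derivatives of a single factor to the whole
  product.\<close>

lemma sm_partial_upd_eq:
  assumes "sm_factor (a i) k (x $ i) = c * sm_factor (a i) (m i) (x $ i)"
  shows "sm_partial A a (m(i := k)) x = c * sm_partial A a m x"
  using sm_partial_upd[of A a m i k x] sm_partial_upd[of A a m i "m i" x] assms by simp

text \<open>Only the j-th factor varies along e_j, so one factor is differentiated and the others
  act as a constant.\<close>

lemma has_pderivative_sm_partial:
  "has_pderivative j (sm_partial A a m) x (sm_partial A a (inc j m) x)"
proof -
  have eq: "sm_partial A a m (x + t *\<^sub>R axis j 1)
      = A * (sm_factor (a j) (m j) (x $ j + t) * (\<Prod>i\<in>UNIV - {j}. sm_factor (a i) (m i) (x $ i)))" for t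
  proof -
    have "(\<Prod>i\<in>UNIV - {j}. sm_factor (a i) (m i) ((x + t *\<^sub>R axis j 1) $ i))
        = (\<Prod>i\<in>UNIV - {j}. sm_factor (a i) (m i) (x $ i))"
      by (intro prod.cong refl) (simp add: axis_def)
    then show ?thesis
      using sm_partial_upd[of A a m j "m j" "x + t *\<^sub>R axis j 1"] by simp
  qed
  have "((\<lambda>t. sm_factor (a j) (m j) (x $ j + t)) has_real_derivative
      sm_factor (a j) (Suc (m j)) (x $ j + 0)) (at 0)"
    by (subst DERIV_at_within_shift[symmetric, of _ _ _ 0 UNIV, simplified]) (simp add: sm_factor_deriv)
  then show ?thesis
    unfolding has_pderivative_real_iff eq inc_def sm_partial_upd
    by (auto intro!: derivative_eq_intros)
qed

text \<open>The quotient c / (exp (c t) - 1) is the logarithmic derivative of 1 - exp (-c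
  t).\<close>

lemma sm_factor_1:
  assumes "c > 0" "t > 0"
  shows "sm_factor c 1 t = c / (exp (c * t) - 1) * sm_factor c 0 t"
proof -
  define e where "e = exp (c * t)"
  have "e > 1" using assms by (simp add: e_def)
  then show ?thesis
    unfolding sm_factor_def minus_mult_left[symmetric] exp_minus e_def[symmetric]
    by (simp add: field_simps)
qed

lemma sm_factor_2: "sm_factor c 2 t = - c * sm_factor c 1 t"
  by (simp add: sm_factor_def power2_eq_square)

section \<open>First and second derivatives of the production function\<close>

context
  fixes f :: "real ^ 'n \<Rightarrow> real" and A :: real and a :: "'n \<Rightarrow> real"
  assumes sm: "spillman_mitscherlich A a f"
begin

text \<open>On the orthant this is the logarithmic derivative f_i / f; it depends on x_i
  alone.\<close>

abbreviation (input) u :: "'n \<Rightarrow> real ^ 'n \<Rightarrow> real" where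
  "u i x \<equiv> a i / (exp (a i * x $ i) - 1)"

lemma a_pos: "a i > 0"
  using sm by (auto simp: spillman_mitscherlich_def)

lemma f_pos: "x \<in> pos_orthant \<Longrightarrow> f x > 0"
  using sm by (auto simp: spillman_mitscherlich_def pos_orthant_def intro!: mult_pos_pos prod_pos)

lemma u_pos: "x \<in> pos_orthant \<Longrightarrow> u i x > 0"
  using a_pos[of i] by (auto simp: pos_orthant_def)

lemma sm_partial_0: "x \<in> pos_orthant \<Longrightarrow> sm_partial A a (\<lambda>_. 0) x = f x"
  using sm by (auto simp: spillman_mitscherlich_def sm_partial_def sm_factor_def)

lemma has_pderivative_f:
  "x \<in> pos_orthant \<Longrightarrow> has_pderivative i f x (sm_partial A a (inc i (\<lambda>_. 0)) x)"
  by (rule has_pderivative_transform_open[OF has_pderivative_sm_partial open_pos_orthant])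
    (auto simp: sm_partial_0)

lemma sm_partial_1:
  assumes "x \<in> pos_orthant"
  shows "sm_partial A a (inc i (\<lambda>_. 0)) x = u i x * f x"
  unfolding inc_def sm_partial_0[OF assms, symmetric]
  by (rule sm_partial_upd_eq) (use assms sm_factor_1[OF a_pos, of "x $ i" i] in \<open>simp add: pos_orthant_def\<close>)

text \<open>Differentiating a second time in the same direction multiplies the factor by - a_i, by
  \<open>sm_factor_2\<close>; in a new direction the untouched j-th factor contributes
  \<open>u j x\<close>.\<close>

lemma sm_partial_2:
  assumes "x \<in> pos_orthant"
  shows "sm_partial A a (inc j (inc i (\<lambda>_. 0))) x = (if i = j then - a i else u j x) * (u i x * f x)"
  unfolding inc_def[of j] sm_partial_1[OF assms, symmetric]
  by (rule sm_partial_upd_eq)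
    (use assms sm_factor_1[OF a_pos, of "x $ j" j] sm_factor_2 in
      \<open>simp add: inc_def pos_orthant_def numeral_2_eq_2\<close>)

lemma pderivative_f: "x \<in> pos_orthant \<Longrightarrow> pderivative i f x = u i x * f x"
  using pderivative_eqI[OF has_pderivative_f] sm_partial_1 by metis

lemma pderivative2_f:
  assumes "x \<in> pos_orthant"
  shows "pderivative2 i j f x = (if i = j then - a i else u j x) * (u i x * f x)"
  unfolding pderivative2_def sm_partial_2[OF assms, symmetric]
  by (intro pderivative_eqI has_pderivative_transform_open[OF has_pderivative_sm_partial open_pos_orthant assms])
    (simp add: pderivative_eqI[OF has_pderivative_f])

section \<open>Output elasticity, PMRS and CES\<close>

text \<open>With e = exp (a_i), equality would mean a_i (e - 1)^2 = 0. The two points differ only in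
  coordinate i, so the same pair also serves to refute PMRS.\<close>

lemma elasticity_neq:
  "1 * u i (\<chi> k. 1) \<noteq> 2 * u i (\<chi> k. if k = i then 2 else 1)"
proof
  define e where "e = exp (a i)"
  have "e > 1" using a_pos[of i] by (simp add: e_def)
  moreover have "exp (a i * 2) = e * e" by (simp add: e_def flip: exp_add)
  moreover have "e * e > 1" using \<open>e > 1\<close> by (rule less_1_mult) (rule \<open>e > 1\<close>)
  moreover assume "1 * u i (\<chi> k. 1) = 2 * u i (\<chi> k. if k = i then 2 else 1)"
  ultimately have "a i * ((e - 1) * (e - 1)) = 0"
    by (simp add: e_def[symmetric] field_simps)
  then show False using \<open>e > 1\<close> a_pos[of i] by simp
qed

lemma output_elasticity_not_constant: "\<not> output_elasticity i f constant_on pos_orthant"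
proof
  have E: "output_elasticity i f x = x $ i * u i x" if "x \<in> pos_orthant" for x
    using f_pos[OF that] by (simp add: output_elasticity_def pderivative_f[OF that])
  have mem: "(\<chi> k. 1) \<in> pos_orthant" "(\<chi> k. if k = i then 2 else 1) \<in> pos_orthant"
    by (auto simp: pos_orthant_def)
  assume "output_elasticity i f constant_on pos_orthant"
  then have "output_elasticity i f (\<chi> k. 1) = output_elasticity i f (\<chi> k. if k = i then 2 else 1)"
    using mem unfolding constant_on_def by metis
  then show False
    using elasticity_neq[of i] E[OF mem(1)] E[OF mem(2)] by simp
qed

text \<open>PMRS would give x_i u_i = x_j u_j. Raising x_i from 1 to 2 changes the left side and
  leaves the right side fixed.\<close>

lemma not_PMRS:
  fixes i j :: 'n
  assumes "i \<noteq> j"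
  shows "\<not> PMRS f"
proof
  assume "PMRS f"
  have E: "x $ j * u j x = x $ i * u i x" if "x \<in> pos_orthant" for x
  proof -
    have "x $ i > 0" "x $ j > 0" using that by (auto simp: pos_orthant_def)
    moreover have "u j x / u i x = x $ i / x $ j"
      using \<open>PMRS f\<close> assms f_pos[OF that] that unfolding PMRS_def MRS_def
      by (fastforce simp: pderivative_f)
    ultimately show ?thesis
      using u_pos[OF that, of i] u_pos[OF that, of j] frac_eq_eq[of "u i x" "x $ j" "u j x" "x $ i"]
      by (metis less_irrefl mult.commute)
  qed
  have mem: "(\<chi> k. 1) \<in> pos_orthant" "(\<chi> k. if k = i then 2 else 1) \<in> pos_orthant"
    by (auto simp: pos_orthant_def)
  show False
    using E[OF mem(1)] E[OF mem(2)] elasticity_neq[of i] assms by simp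
qed

text \<open>Where all a_k x_k equal t, u_k = a_k / (e - 1) with e = exp t, and the a_k cancel: the
  numerator is 2 (e - 1) / (t f) and the denominator 2 e / f.\<close>

lemma hicks_elasticity_diagonal:
  assumes "i \<noteq> j" "t > 0"
  shows "hicks_elasticity i j f (\<chi> k. t / a k) = (1 - exp (- t)) / t"
proof -
  define x where "x = (\<chi> k. t / a k)"
  define e where "e = exp t"
  have x: "x \<in> pos_orthant"
    using a_pos \<open>t > 0\<close> by (simp add: x_def pos_orthant_def)
  have a0: "a k \<noteq> 0" for k using a_pos[of k] by simp
  have e: "e > 1" using \<open>t > 0\<close> by (simp add: e_def)
  have u: "u k x = a k / (e - 1)" for k
    using a0[of k] by (simp add: x_def e_def)
  have xk: "x $ k = t / a k" for k by (simp add: x_def)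
  define F where "F = f x"
  have F: "F > 0" using f_pos[OF x] by (simp add: F_def)
  have 1: "1 / (x $ k * pderivative k f x) = (e - 1) / (t * F)" for k
    using a0[of k] by (simp add: pderivative_f[OF x] xk e_def F_def)
  have 2: "pderivative2 k k f x / (pderivative k f x)\<^sup>2 = - ((e - 1) / F)" for k
    using a0[of k] e F
    by (simp add: pderivative_f[OF x] pderivative2_f[OF x] u F_def[symmetric] power2_eq_square flip: minus_divide_left)
  have 3: "2 * pderivative2 i j f x / (pderivative i f x * pderivative j f x) = 2 / F"
    using a0[of i] a0[of j] e F \<open>i \<noteq> j\<close>
    by (simp add: pderivative_f[OF x] pderivative2_f[OF x] u F_def[symmetric])
  have "hicks_elasticity i j f x = (2 * (e - 1) / (t * F)) / (2 * e / F)"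
    unfolding hicks_elasticity_def 1 2 3 by (simp add: diff_divide_distrib mult.commute)
  also have "\<dots> = (1 - 1 / e) / t"
    using e F \<open>t > 0\<close> by (simp add: field_simps)
  finally show ?thesis
    by (simp add: x_def e_def exp_minus inverse_eq_divide)
qed

lemma not_CES:
  fixes i j :: 'n
  assumes "i \<noteq> j"
  shows "\<not> CES f"
proof
  assume "CES f"
  then obtain \<sigma> where \<sigma>: "\<And>x. x \<in> pos_orthant \<Longrightarrow> hicks_elasticity i j f x = \<sigma>"
    using assms unfolding CES_def by blast
  have "(\<chi> k. t / a k) \<in> pos_orthant" if "t > 0" for t
    using that a_pos by (simp add: pos_orthant_def)
  \<comment> \<open>Comparing t = 1 with t = 2: for q = exp (-1) the equality reads 2 (1 - q) = 1 -
    q^2, that is (1 - q)^2 = 0.\<close>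
  then have "(1 - exp (- 1)) / 1 = (1 - exp (- 2)) / (2 :: real)"
    using hicks_elasticity_diagonal[OF assms, of 1] hicks_elasticity_diagonal[OF assms, of 2]
      \<sigma>[of "\<chi> k. 1 / a k"] \<sigma>[of "\<chi> k. 2 / a k"] by simp
  moreover have "exp (- 2) = exp (- 1) * exp (- 1 :: real)"
    by (simp flip: exp_add)
  ultimately have "(1 - exp (- 1)) * (1 - exp (- 1)) = (0 :: real)"
    by (simp add: algebra_simps)
  then show False by simp
qed

section \<open>Gauss-Kronecker curvature\<close>

text \<open>The Hessian has trivial kernel: a kernel vector v satisfies (a_i + u_i) v_i = s for all
  i, where s = u . v. Solving for v_i and summing u_i v_i gives s = s times the sum of the
  exponentials, so s = 0 and v = 0.\<close>

lemma gauss_kronecker_curvature_nonzero: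
  assumes x: "x \<in> pos_orthant" and neq_1: "(\<Sum>i\<in>UNIV. exp (- (a i * x $ i))) \<noteq> 1"
  shows "gauss_kronecker_curvature f x \<noteq> 0"
proof -
  let ?M = "\<chi> i j. pderivative2 i j f x"
  have "v = 0" if "?M *v v = 0" for v
  proof -
    define s where "s = (\<Sum>j\<in>UNIV. u j x * v $ j)"
    have v: "(a i + u i x) * v $ i = s" for i
    proof -
      have "0 = (\<Sum>j\<in>UNIV. (if i = j then - a i else u j x) * (u i x * f x) * v $ j)"
        using arg_cong[OF that, of "\<lambda>w. w $ i"] by (simp add: matrix_vector_mult_def pderivative2_f[OF x])
      \<comment> \<open>The diagonal entry - a_i u_i f is split as u_i u_i f - (a_i + u_i) u_i f,
        which exposes the rank-one part.\<close>
      also have "\<dots> = (\<Sum>j\<in>UNIV. u i x * f x * (u j x * v $ j)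
          - (if i = j then u i x * f x * ((a i + u i x) * v $ i) else 0))"
        by (intro sum.cong refl) (auto simp: algebra_simps)
      also have "\<dots> = u i x * f x * (s - (a i + u i x) * v $ i)"
        by (simp add: sum_subtractf s_def sum_distrib_left right_diff_distrib del: times_divide_eq_left)
      finally show ?thesis
        using u_pos[OF x, of i] f_pos[OF x] by (metis eq_iff_diff_eq_0 less_irrefl mult_eq_0_iff)
    qed
    \<comment> \<open>Here u_i / (a_i + u_i) = exp (- a_i x_i).\<close>
    have uv: "u i x * v $ i = s * exp (- (a i * x $ i))" for i
    proof -
      define e where "e = exp (a i * x $ i)"
      have "e > 1" using x a_pos[of i] by (simp add: e_def pos_orthant_def)
      then show ?thesis
        using a_pos[of i] unfolding v[of i, symmetric] exp_minus e_def[symmetric]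
        by (simp add: field_simps)
    qed
    have "s = s * (\<Sum>i\<in>UNIV. exp (- (a i * x $ i)))"
      unfolding sum_distrib_left uv[symmetric] by (simp add: s_def)
    then have "s = 0" using neq_1 by simp
    then have "v $ i = 0" for i
      using v[of i] u_pos[OF x, of i] a_pos[of i] by (smt (verit) mult_eq_0_iff)
    then show ?thesis by (simp add: vec_eq_iff)
  qed
  then have "det ?M \<noteq> 0"
    unfolding invertible_det_nz[symmetric] invertible_left_inverse matrix_left_invertible_ker by blast
  moreover have "sqrt (1 + (\<Sum>i\<in>UNIV. (pderivative i f x)\<^sup>2)) \<noteq> 0"
    by (smt (verit) real_sqrt_eq_zero_cancel_iff sum_nonneg zero_le_power2)
  ultimately show ?thesis
    unfolding gauss_kronecker_curvature_def by simp
qed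

text \<open>For two or more inputs the Hessian is singular at the points of the orthant where the
  exponentials sum to 1, so non-vanishing is meant as not vanishing identically. The witness has a_k
  x_k = n for all k, where the sum is n exp (-n) < 1.\<close>

lemma gauss_kronecker_curvature_not_identically_0:
  "\<exists>x\<in>pos_orthant. gauss_kronecker_curvature f x \<noteq> 0"
proof
  let ?n = "real CARD('n)"
  let ?x = "(\<chi> k. ?n / a k) :: real ^ 'n"
  have a0: "a k \<noteq> 0" for k using a_pos[of k] by simp
  show x: "?x \<in> pos_orthant"
    using a_pos by (simp add: pos_orthant_def)
  have "?n < exp ?n"
    using exp_ge_add_one_self[of ?n] by linarith
  then have "(\<Sum>i\<in>UNIV. exp (- (a i * ?x $ i))) \<noteq> 1"
    by (simp add: a0 exp_minus field_simps)
  with x show "gauss_kronecker_curvature f ?x \<noteq> 0"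
    by (rule gauss_kronecker_curvature_nonzero)
qed

section \<open>Non-flatness\<close>

text \<open>At a_k x_k = 1 one has u_k = a_k / c with c = exp 1 - 1. A vanishing minor f_ii f_jj =
  f_ij^2 would force c^2 = 1, whereas c > 1.\<close>

lemma not_flat:
  fixes i j :: 'n
  assumes "i \<noteq> j"
  shows "\<not> flat_on pos_orthant (production_hypersurface f)"
proof
  assume flat: "flat_on pos_orthant (production_hypersurface f)"
  let ?x = "(\<chi> k. 1 / a k) :: real ^ 'n"
  let ?H = "\<lambda>i j. sm_partial A a (inc j (inc i (\<lambda>_. 0)))"
  have x: "?x \<in> pos_orthant"
    using a_pos by (simp add: pos_orthant_def)
  have a0: "a k \<noteq> 0" for k using a_pos[of k] by simp
  \<comment> \<open>Taking l = i and k = j selects the principal minor in rows and columns i,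
    j.\<close>
  have "?H i i ?x * ?H j j ?x = ?H i j ?x * ?H i j ?x"
    by (rule flat_graph_hessian_minor[where H = ?H and l = i and i = i and j = j and k = j,
          OF flat open_pos_orthant x has_pderivative_f
          has_pderivative_sm_partial has_pderivative_sm_partial])
      (simp_all add: inc_commute)
  moreover define c where "c = exp 1 - (1 :: real)"
  have "u k ?x = a k / c" for k
    using a0[of k] by (simp add: c_def)
  ultimately have "(- a i * (a i / c * f ?x)) * (- a j * (a j / c * f ?x))
      = (a j / c * (a i / c * f ?x)) * (a j / c * (a i / c * f ?x))"
    using assms by (simp only: sm_partial_2[OF x] simp_thms if_True if_False)
  moreover have "c > 1"
    using exp_lower_Taylor_quadratic[of 1] by (simp add: c_def)
  moreover have "f ?x > 0"
    by (rule f_pos[OF x])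
  ultimately have "c * c = 1"
    using a0 by (simp add: field_simps)
  then show False
    using less_1_mult[OF \<open>c > 1\<close> \<open>c > 1\<close>] by simp
qed

end

theorem corollary4p3:
  fixes f :: "real ^ 'n \<Rightarrow> real" and A :: real and a :: "'n \<Rightarrow> real"
  assumes "CARD('n) \<ge> 2"
    and "spillman_mitscherlich A a f"
  shows "(\<forall>i. \<not> output_elasticity i f constant_on pos_orthant)
    \<and> \<not> PMRS f
    \<and> \<not> CES f
    \<and> \<not> (\<forall>x\<in>pos_orthant. gauss_kronecker_curvature f x = 0)
    \<and> \<not> flat_on pos_orthant (production_hypersurface f)"
proof -
  \<comment> \<open>With a single input PMRS and CES would hold vacuously and the graph would be a
    flat curve, so two distinct indices are essential.\<close>
  obtain i j :: 'n where "i \<noteq> j"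
    using assms(1) card_le_Suc0_iff_eq[of "UNIV :: 'n set"] by fastforce
  then show ?thesis
    using output_elasticity_not_constant[OF assms(2)] not_PMRS[OF assms(2)] not_CES[OF assms(2)]
      gauss_kronecker_curvature_not_identically_0[OF assms(2)] not_flat[OF assms(2)]
    by blast
qed

end
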